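(* Let $a,b,c,k,l,m$ be positive integers with $c\mid ab$ and $k,l\ge m$, and let $d_i^{\pm}=a^{2k}b^{2l}\pm i c^m$ for $i=1,2$, where each $d_i^\pm$ under consideration is a square-free positive integer. Then the equation $x^2-d_i^{\pm}y^2=-4$ (any $i\in\{1,2\}$, either sign) has no positive integer solution, with the exception of the equation $x^2-d_1^+y^2=-4$ in the case $c=1$.
   Formalization: Non-solvability is asserted only for d_i^± ≠ 2, since the statement fails when d_i^± = 2 (e.g. a=2, b=c=k=l=m=1 gives d_2^-=2 and x=y=2 is a solution); the exceptional equation is shown to be solvable. *)

theory Defs
  imports "HOL-Computational_Algebra.Computational_Algebra"
begin

text \<open>The sign of \<open>d\<^sub>i\<^sup>\<plusminus>\<close> is the argument \<open>s\<close>, taken from \<open>{1, -1}\<close>. Values are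
  integers, so that the minus case is not truncated at zero.\<close>

definition pell_d :: "int \<Rightarrow> nat \<Rightarrow> nat \<Rightarrow> nat \<Rightarrow> nat \<Rightarrow> nat \<Rightarrow> nat \<Rightarrow> nat \<Rightarrow> int" where
  "pell_d s i a b c k l m = int a ^ (2 * k) * int b ^ (2 * l) + s * int i * int c ^ m"

definition neg4_solvable :: "int \<Rightarrow> bool" where
  "neg4_solvable d \<longleftrightarrow> (\<exists>x y :: int. x > 0 \<and> y > 0 \<and> x\<^sup>2 - d * y\<^sup>2 = - 4)"

text \<open>The value \<open>d = 2\<close> has to be set apart: it arises as \<open>d\<^sub>2\<^sup>-\<close> for \<open>c = 1\<close> and as
  \<open>d\<^sub>1\<^sup>-\<close> for \<open>c = 2\<close> (with \<open>a = 2\<close>, \<open>b = k = l = m = 1\<close>), although \<open>2\<^sup>2 - 2 * 2\<^sup>2 = - 4\<close>.\<close>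

lemma pell_d_eq_2:
  "pell_d (-1) 2 2 1 1 1 1 1 = 2"
  "pell_d (-1) 1 2 1 2 1 1 1 = 2"
  by (simp_all add: pell_d_def)

lemma squarefree_2: "squarefree (2 :: int)"
  by (simp add: squarefree_prime)

lemma neg4_solvable_2: "neg4_solvable 2"
  unfolding neg4_solvable_def by (rule exI[of _ 2], rule exI[of _ 2]) simp

end

theory Submission
  imports Defs
begin

text \<open>
  Since \<open>c ^ m\<close> divides \<open>a ^ k * b ^ l\<close>, excluding \<open>4 dvd d\<close> and \<open>d mod 4 = 3\<close> leaves
  \<open>d = (C * n)\<^sup>2 + \<sigma> * C\<close> with \<open>\<sigma> = \<plusminus>1\<close>, where \<open>C = c ^ m\<close> or \<open>C = 2 * c ^ m\<close>; the factor \<open>i = 2\<close> is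
  absorbed into \<open>C\<close>. For such \<open>d\<close> the number \<open>\<eta> = X + 2 * n * \<surd>d\<close> with \<open>X = 2 * C * n\<^sup>2 + \<sigma>\<close> is a unit
  of norm 1. Dividing a solution \<open>(x + y * \<surd>d) / 2\<close> of norm \<open>-1\<close> by \<open>\<eta>\<close> strictly decreases
  \<open>\<bar>y\<bar>\<close>, unless \<open>y\<close> is already so small that only \<open>y = 1\<close> and \<open>C \<le> 5\<close> remain.
\<close>

lemma square_mod_4: "(x::int)\<^sup>2 mod 4 = (if even x then 0 else 1)"
proof (cases "even x")
  case True
  then obtain k where "x = 2 * k" by blast
  then show ?thesis by (simp add: power2_eq_square)
next
  case False
  then obtain k where "x = 2 * k + 1" by (elim oddE)
  then have "x\<^sup>2 = 4 * (k * k + k) + 1" by (simp add: power2_eq_square algebra_simps)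
  then show ?thesis using False by presburger
qed

lemma square_mod_3_neq_2: "(x::int)\<^sup>2 mod 3 \<noteq> 2"
proof -
  have "x mod 3 = 0 \<or> x mod 3 = 1 \<or> x mod 3 = 2" by presburger
  then have "(x mod 3)\<^sup>2 mod 3 \<noteq> 2" by auto
  then show ?thesis by (simp add: power_mod)
qed

lemma neg4_unsolvable_mod_4:
  fixes x y d :: int
  assumes "d mod 4 = 3"
  shows "x\<^sup>2 - d * y\<^sup>2 \<noteq> -4"
proof
  assume eq: "x\<^sup>2 - d * y\<^sup>2 = -4"
  obtain q where q: "d = 4 * q + 3"
    using assms by (metis mult_div_mod_eq)
  have "x\<^sup>2 + y\<^sup>2 = 4 * ((q + 1) * y\<^sup>2 - 1)"
    using eq by (simp add: q algebra_simps)
  then have "(x\<^sup>2 + y\<^sup>2) mod 4 = 0" by simp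
  then have "(x\<^sup>2 mod 4 + y\<^sup>2 mod 4) mod 4 = 0" by (simp add: mod_add_eq)
  then have "even x" "even y"
    by (auto simp: square_mod_4 split: if_splits)
  then obtain u v where uv: "x = 2 * u" "y = 2 * v" by blast
  then have "u\<^sup>2 + v\<^sup>2 = 4 * ((q + 1) * v\<^sup>2) - 1"
    using eq by (simp add: q power_mult_distrib algebra_simps)
  then have "(u\<^sup>2 + v\<^sup>2) mod 4 = 3" by presburger
  then have "(u\<^sup>2 mod 4 + v\<^sup>2 mod 4) mod 4 = 3" by (simp add: mod_add_eq)
  then show False
    by (auto simp: square_mod_4 split: if_splits)
qed

lemma neg4_small_solution_impossible:
  fixes C n \<sigma> d x y :: int
  assumes "C \<ge> 2" and "n \<ge> 1" and \<sigma>: "\<sigma> \<in> {1, -1}"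
    and d: "d = C\<^sup>2 * n\<^sup>2 + \<sigma> * C" and not4: "\<not> 4 dvd d" and "d \<noteq> 2"
    and "y > 0" and eq: "x\<^sup>2 - d * y\<^sup>2 = -4"
    and small: "(2 * C * n\<^sup>2 + \<sigma> - 1) * y\<^sup>2 \<le> 8 * n\<^sup>2"
  shows False
proof -
  have n2: "n\<^sup>2 \<ge> 1" using \<open>n \<ge> 1\<close> by (simp add: one_le_power)
  have Cn: "C * n\<^sup>2 \<ge> 2 * n\<^sup>2" using \<open>C \<ge> 2\<close> n2 by (intro mult_right_mono) auto
  have "y = 1"
  proof (rule ccontr)
    assume "y \<noteq> 1"
    then have "2 \<le> y" using \<open>y > 0\<close> by simp
    then have "2\<^sup>2 \<le> y\<^sup>2" by (intro power_mono) auto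
    then have "(2 * C * n\<^sup>2 + \<sigma> - 1) * 4 \<le> (2 * C * n\<^sup>2 + \<sigma> - 1) * y\<^sup>2"
      using Cn n2 \<sigma> by (intro mult_left_mono) auto
    then have le: "C * n\<^sup>2 \<le> n\<^sup>2 + 1" and "\<sigma> = -1"
      using small Cn n2 \<sigma> by auto
    then have "n\<^sup>2 = 1" using Cn n2 by linarith
    then have "n = 1" using \<open>n \<ge> 1\<close> by (simp add: power2_eq_1_iff)
    then have "C = 2" using le \<open>C \<ge> 2\<close> by simp
    then show False using d \<open>n = 1\<close> \<open>\<sigma> = -1\<close> \<open>d \<noteq> 2\<close> by simp
  qed
  have x2: "x\<^sup>2 = C\<^sup>2 * n\<^sup>2 + \<sigma> * C - 4" using eq d \<open>y = 1\<close> by simp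
  have bound: "C * n\<^sup>2 \<le> 4 * n\<^sup>2 + 1" using small \<open>y = 1\<close> \<sigma> by auto
  have "C \<le> 5"
  proof (rule ccontr)
    assume "\<not> C \<le> 5"
    then have "6 * n\<^sup>2 \<le> C * n\<^sup>2" using n2 by (intro mult_right_mono) auto
    then show False using bound n2 by simp
  qed
  then consider "C = 2" | "C = 3" | "C = 4" | "C = 5" using \<open>C \<ge> 2\<close> by linarith
  then show False
  proof cases
    case 1
    then have "x\<^sup>2 mod 4 = 2" using x2 \<sigma> by (auto; presburger)
    then show False by (simp add: square_mod_4 split: if_splits)
  next
    case 2
    then have "x\<^sup>2 = 3 * (3 * n\<^sup>2 + \<sigma> - 2) + 2" using x2 by simp
    then have "x\<^sup>2 mod 3 = 2" by presburger
    then show False by (simp add: square_mod_3_neq_2)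
  next
    case 3
    then show False using d not4 \<sigma> by auto
  next
    case 4
    then have "n\<^sup>2 = 1" using bound n2 by simp
    moreover have "\<sigma> = -1" using 4 small \<open>y = 1\<close> n2 \<sigma> by auto
    ultimately have "d = 20" using 4 d by simp
    then show False using not4 by simp
  qed
qed

lemma neg4_unsolvable:
  fixes C n \<sigma> d x y :: int
  assumes "C \<ge> 2" and "n \<ge> 1" and \<sigma>: "\<sigma> \<in> {1, -1}"
    and d: "d = C\<^sup>2 * n\<^sup>2 + \<sigma> * C" and not4: "\<not> 4 dvd d" and "d \<noteq> 2"
    and "x \<ge> 0" and "y > 0"
  shows "x\<^sup>2 - d * y\<^sup>2 \<noteq> -4"
  using \<open>x \<ge> 0\<close> \<open>y > 0\<close>
proof (induction "nat y" arbitrary: x y rule: less_induct)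
  case less
  show ?case
  proof
    assume eq: "x\<^sup>2 - d * y\<^sup>2 = -4"
    define X where "X = 2 * C * n\<^sup>2 + \<sigma>"
    have \<sigma>2: "\<sigma> * \<sigma> = 1" using \<sigma> by auto
    have X2: "X\<^sup>2 = 4 * n\<^sup>2 * d + 1"
      unfolding X_def d using \<sigma>2 by (simp add: power2_eq_square algebra_simps)
    have n2: "n\<^sup>2 \<ge> 1" using \<open>n \<ge> 1\<close> by (simp add: one_le_power)
    have Cn: "C * n\<^sup>2 \<ge> 2 * n\<^sup>2" using \<open>C \<ge> 2\<close> n2 by (intro mult_right_mono) auto
    have "X \<ge> 3" using Cn n2 \<sigma> by (auto simp: X_def)
    have large: "(X - 1) * y\<^sup>2 > 8 * n\<^sup>2"
      using neg4_small_solution_impossible[OF \<open>C \<ge> 2\<close> \<open>n \<ge> 1\<close> \<sigma> d not4 \<open>d \<noteq> 2\<close> \<open>y > 0\<close> eq]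
      unfolding X_def by (meson not_le)
    have "(2 * n * x)\<^sup>2 = 4 * n\<^sup>2 * (d * y\<^sup>2 - 4)"
      using eq by (simp add: power_mult_distrib)
    also have "\<dots> = (X\<^sup>2 - 1) * y\<^sup>2 - 16 * n\<^sup>2"
      by (simp add: X2 algebra_simps)
    finally have nx: "(2 * n * x)\<^sup>2 = (X\<^sup>2 - 1) * y\<^sup>2 - 16 * n\<^sup>2" .
    have "((X + 1) * y)\<^sup>2 - (2 * n * x)\<^sup>2 = 2 * ((X + 1) * y\<^sup>2) + 16 * n\<^sup>2"
      unfolding nx by (simp add: power2_eq_square algebra_simps)
    moreover have "0 \<le> (X + 1) * y\<^sup>2" using \<open>X \<ge> 3\<close> by simp
    ultimately have "(2 * n * x)\<^sup>2 < ((X + 1) * y)\<^sup>2" using n2 by linarith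
    then have upper: "2 * n * x < (X + 1) * y"
      by (rule power2_less_imp_less) (use \<open>X \<ge> 3\<close> less.prems in simp)
    have "(2 * n * x)\<^sup>2 - ((X - 1) * y)\<^sup>2 = 2 * ((X - 1) * y\<^sup>2) - 16 * n\<^sup>2"
      unfolding nx by (simp add: power2_eq_square algebra_simps)
    then have "((X - 1) * y)\<^sup>2 < (2 * n * x)\<^sup>2" using large by linarith
    then have lower: "(X - 1) * y < 2 * n * x"
      by (rule power2_less_imp_less) (use \<open>n \<ge> 1\<close> less.prems in simp)
    define x' where "x' = \<bar>X * x - 2 * n * d * y\<bar>"
    define y' where "y' = \<bar>X * y - 2 * n * x\<bar>"
    have "x'\<^sup>2 - d * y'\<^sup>2 = (X\<^sup>2 - 4 * n\<^sup>2 * d) * (x\<^sup>2 - d * y\<^sup>2)"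
      unfolding x'_def y'_def power2_abs by (simp add: power2_eq_square algebra_simps)
    also have "\<dots> = -4" by (simp add: X2 eq)
    finally have eq': "x'\<^sup>2 - d * y'\<^sup>2 = -4" .
    have "y' < y" using lower upper by (simp add: y'_def algebra_simps)
    moreover have "y' > 0"
    proof (rule ccontr)
      assume "\<not> y' > 0"
      then have "y' = 0" by (simp add: y'_def)
      then show False using eq' zero_le_power2[of x'] by simp
    qed
    ultimately show False
      using less.hyps[of y' x'] eq' by (simp add: x'_def)
  qed
qed

theorem theorem4p9:
  fixes a b c k l m i :: nat and s d :: int
  assumes "a > 0" and "b > 0" and "c > 0" and "k > 0" and "l > 0" and "m > 0"
    and "c dvd a * b" and "k \<ge> m" and "l \<ge> m"
    and "i \<in> {1, 2}" and "s \<in> {1, -1}"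
    and "d = pell_d s i a b c k l m"
    and "d > 0" and "squarefree d"
  shows "(\<not> (i = 1 \<and> s = 1 \<and> c = 1) \<and> d \<noteq> 2 \<longrightarrow> \<not> neg4_solvable d) \<and>
         (i = 1 \<and> s = 1 \<and> c = 1 \<longrightarrow> neg4_solvable d)"
proof -
  define N where "N = int a ^ k * int b ^ l"
  define C where "C = int c ^ m"
  have d: "d = N\<^sup>2 + s * int i * C"
    by (simp add: assms(12) pell_d_def N_def C_def power_mult_distrib power_even_eq)
  have "N > 0" "C > 0" using assms(1-3) by (simp_all add: N_def C_def)
  have "int c dvd int a * int b"
    using assms(7) by (metis of_nat_dvd_iff of_nat_mult)
  then have "C dvd int a ^ m * int b ^ m"
    unfolding C_def by (metis dvd_power_same power_mult_distrib)
  also have "\<dots> dvd N"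
    unfolding N_def using assms(8,9) by (intro mult_dvd_mono le_imp_power_dvd)
  finally obtain n where N: "N = C * n" by blast
  have "n \<ge> 1" using \<open>N > 0\<close> \<open>C > 0\<close> by (simp add: N zero_less_mult_iff)
  have d': "d = C\<^sup>2 * n\<^sup>2 + s * int i * C" by (simp add: d N power_mult_distrib)
  have not4: "\<not> 4 dvd d"
  proof
    assume "4 dvd d"
    then have "(2::int)\<^sup>2 dvd d" by simp
    then have "is_unit (2::int)" using assms(14) by (rule squarefreeD[rotated])
    then show False by simp
  qed
  have "neg4_solvable d" if "i = 1 \<and> s = 1 \<and> c = 1"
  proof -
    have "(2 * N)\<^sup>2 - d * 2\<^sup>2 = -4" using that by (simp add: d C_def power_mult_distrib)
    then show ?thesis unfolding neg4_solvable_def using \<open>N > 0\<close>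
      by (intro exI[of _ "2 * N"] exI[of _ 2]) simp
  qed
  moreover have "x\<^sup>2 - d * y\<^sup>2 \<noteq> -4"
    if exc: "\<not> (i = 1 \<and> s = 1 \<and> c = 1)" and "d \<noteq> 2" and "x > 0" "y > 0" for x y
  proof -
    consider "i = 1" "C \<ge> 2" | "i = 1" "C = 1" | "i = 2"
      using \<open>C > 0\<close> assms(10) by fastforce
    then show ?thesis
    proof cases
      case 1
      show ?thesis
        by (rule neg4_unsolvable[of C n s]) (use 1 \<open>n \<ge> 1\<close> assms(11) d' not4 that in auto)
    next
      case 2
      then have "c ^ m = 1" by (simp add: C_def flip: of_nat_power)
      then have "c = 1" using \<open>m > 0\<close> by simp
      then have "s = -1" using 2 exc assms(11) by auto
      then have "d = n\<^sup>2 - 1" using 2 d' by simp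
      then have "d mod 4 = 3"
        using not4 square_mod_4[of n] by presburger
      then show ?thesis by (rule neg4_unsolvable_mod_4)
    next
      case 3
      have "odd C"
      proof
        assume "even C"
        then obtain q where "C = 2 * q" by blast
        then have "d = 4 * (q\<^sup>2 * n\<^sup>2 + s * q)" using 3 d' by (simp add: power_mult_distrib)
        then show False using not4 by simp
      qed
      show ?thesis
      proof (cases "even n")
        case True
        then obtain q where q: "n = 2 * q" by blast
        show ?thesis
          by (rule neg4_unsolvable[of "2 * C" q s])
            (use 3 q \<open>n \<ge> 1\<close> \<open>C > 0\<close> assms(11) d' not4 that in \<open>auto simp: power_mult_distrib\<close>)
      next
        case False
        then have "N\<^sup>2 mod 4 = 1" using \<open>odd C\<close> by (simp add: square_mod_4 N)
        then obtain t where t: "N\<^sup>2 = 4 * t + 1" by (metis mult_div_mod_eq)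
        obtain q where q: "C = 2 * q + 1" using \<open>odd C\<close> by (elim oddE)
        have "d = 4 * (t + q) + 3 \<or> d = 4 * (t - q - 1) + 3"
          using 3 d t q assms(11) by auto
        then obtain u where "d = 4 * u + 3" by blast
        then have "d mod 4 = 3" by simp
        then show ?thesis by (rule neg4_unsolvable_mod_4)
      qed
    qed
  qed
  ultimately show ?thesis unfolding neg4_solvable_def by blast
qed

end
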